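(* Let $(\Omega, \mathcal F, (\mathcal F_t)_{t \geq 0}, \mathsf P)$ be a filtered probability space with $\bigcup_{t \geq 0} \mathcal F_t \subset \mathcal F$. Let $N \in \mathbb{N}_0 = \{0,1,2,\dots\}$ and let $0 \leq \rho_1 \leq \cdots \leq \rho_N$ be stopping times (with values in $[0,\infty]$). For each $m = 1, \dots, N$ let $J_m$ be an $\mathcal F_{\rho_m}$-measurable random variable. Suppose that the process $M = (M_t)_{t\ge 0}$ given by \[ M_t = \sum_{m=1}^N J_m \mathbf{1}_{\{t \geq \rho_m\}}, \qquad t \geq 0, \] is a local martingale. If \[ \mathsf E\Big[\liminf_{t \uparrow \infty} M_t^-\Big] < \infty, \] then $M$ is a uniformly integrable martingale.
   Context: $x^- = \max(-x,0)$ denotes the negative part. A local martingale is an adapted process $M$ for which there is a nondecreasing sequence of stopping times $\tau_n \uparrow \infty$ such that each stopped process $M^{\tau_n} = (M_{t \wedge \tau_n})_{t\ge0}$ is a uniformly integrable martingale. The empty sum (case $N=0$) is $M \equiv 0$. *)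

theory Defs
  imports "HOL-Probability.Probability"
begin

text \<open>Continuous-time setting: time parameter t :: real, only t \<ge> 0 matters.
  Stopping times take values in [0,\<infinity>] and are modelled as ennreal-valued.\<close>

definition filtration_on :: "'a measure \<Rightarrow> (real \<Rightarrow> 'a measure) \<Rightarrow> bool" where
  "filtration_on M F \<longleftrightarrow>
     (\<forall>t\<ge>0. space (F t) = space M \<and> sets (F t) \<subseteq> sets M) \<and>
     (\<forall>s t. 0 \<le> s \<longrightarrow> s \<le> t \<longrightarrow> sets (F s) \<subseteq> sets (F t))"

definition stopping_time_on :: "(real \<Rightarrow> 'a measure) \<Rightarrow> ('a \<Rightarrow> ennreal) \<Rightarrow> bool" where
  "stopping_time_on F \<tau> \<longleftrightarrow> (\<forall>t\<ge>0. {\<omega>\<in>space (F t). \<tau> \<omega> \<le> ennreal t} \<in> sets (F t))"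

definition F_infty :: "(real \<Rightarrow> 'a measure) \<Rightarrow> 'a set set" where
  "F_infty F = sigma_sets (space (F 0)) (\<Union>t\<in>{0..}. sets (F t))"

definition pre_sigma_on :: "(real \<Rightarrow> 'a measure) \<Rightarrow> ('a \<Rightarrow> ennreal) \<Rightarrow> 'a measure" where
  "pre_sigma_on F \<tau> = sigma (space (F 0))
     {A \<in> F_infty F. \<forall>t\<ge>0. {\<omega>\<in>A. \<tau> \<omega> \<le> ennreal t} \<in> sets (F t)}"

definition adapted_on :: "(real \<Rightarrow> 'a measure) \<Rightarrow> (real \<Rightarrow> 'a \<Rightarrow> real) \<Rightarrow> bool" where
  "adapted_on F X \<longleftrightarrow> (\<forall>t\<ge>0. X t \<in> borel_measurable (F t))"

text \<open>Martingale: adapted, integrable, and E[X_t | F_s] = X_s for s \<le> t, expressed via the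
  defining property of conditional expectation.\<close>

definition martingale_on :: "'a measure \<Rightarrow> (real \<Rightarrow> 'a measure) \<Rightarrow> (real \<Rightarrow> 'a \<Rightarrow> real) \<Rightarrow> bool" where
  "martingale_on M F X \<longleftrightarrow> adapted_on F X \<and> (\<forall>t\<ge>0. integrable M (X t)) \<and>
     (\<forall>s t A. 0 \<le> s \<longrightarrow> s \<le> t \<longrightarrow> A \<in> sets (F s) \<longrightarrow>
        (LINT \<omega>:A|M. X t \<omega>) = (LINT \<omega>:A|M. X s \<omega>))"

definition uniformly_integrable_on :: "'a measure \<Rightarrow> (real \<Rightarrow> 'a \<Rightarrow> real) \<Rightarrow> bool" where
  "uniformly_integrable_on M X \<longleftrightarrow> (\<forall>t\<ge>0. integrable M (X t)) \<and>
     (\<forall>e>0. \<exists>K. \<forall>t\<ge>0. (LINT \<omega>:{\<omega>\<in>space M. K < \<bar>X t \<omega>\<bar>}|M. \<bar>X t \<omega>\<bar>) \<le> e)"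

definition UI_martingale_on :: "'a measure \<Rightarrow> (real \<Rightarrow> 'a measure) \<Rightarrow> (real \<Rightarrow> 'a \<Rightarrow> real) \<Rightarrow> bool" where
  "UI_martingale_on M F X \<longleftrightarrow> martingale_on M F X \<and> uniformly_integrable_on M X"

definition stopped_process :: "(real \<Rightarrow> 'a \<Rightarrow> real) \<Rightarrow> ('a \<Rightarrow> ennreal) \<Rightarrow> real \<Rightarrow> 'a \<Rightarrow> real" where
  "stopped_process X \<tau> = (\<lambda>t \<omega>. if ennreal t \<le> \<tau> \<omega> then X t \<omega> else X (enn2real (\<tau> \<omega>)) \<omega>)"

definition local_martingale_on :: "'a measure \<Rightarrow> (real \<Rightarrow> 'a measure) \<Rightarrow> (real \<Rightarrow> 'a \<Rightarrow> real) \<Rightarrow> bool" where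
  "local_martingale_on M F X \<longleftrightarrow> adapted_on F X \<and>
     (\<exists>\<tau> :: nat \<Rightarrow> 'a \<Rightarrow> ennreal.
        (\<forall>n. stopping_time_on F (\<tau> n)) \<and>
        (\<forall>n. \<forall>\<omega>\<in>space M. \<tau> n \<omega> \<le> \<tau> (Suc n) \<omega>) \<and>
        (AE \<omega> in M. (\<lambda>n. \<tau> n \<omega>) \<longlonglongrightarrow> \<infinity>) \<and>
        (\<forall>n. UI_martingale_on M F (stopped_process X (\<tau> n))))"

end

theory Submission
  imports Defs
begin

text \<open>Put \<open>R 0 = 0\<close>, \<open>R k = \<rho> k\<close> for \<open>1 \<le> k \<le> N\<close>, \<open>R k = \<infinity>\<close> for \<open>k > N\<close>, and let \<open>Y k\<close> be the
  value of the process at time \<open>R k\<close>. Let \<open>Z n\<close> be the value at time \<open>n\<close> of the process stopped at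
  the localizing time \<open>\<tau> n\<close>, and \<open>B n k = {R k \<le> min n (\<tau> n)}\<close>. Optional sampling at \<open>R k\<close>
  together with \<open>Z n = Y k\<close> on \<open>B n k - B n (Suc k)\<close> yields
  \<open>E[(Y k)\<^sup>-; B n (Suc k)] \<le> E[(Z n)\<^sup>-; B n (Suc k)]\<close>, and the right-hand side only involves
  \<open>Y j\<close> with \<open>j > k\<close>. On \<open>{R k < \<infinity> = R (Suc k)}\<close> the variable \<open>Y k\<close> is the terminal value of the
  process, so backward induction on \<open>k\<close> shows that every \<open>(Y k)\<^sup>-\<close> is integrable on \<open>{R k < \<infinity>}\<close>.
  Hence \<open>E[(Z n)\<^sup>-]\<close>, and by \<open>E[Z n] = E[X 0]\<close> also \<open>E[(Z n)\<^sup>+]\<close>, is bounded in \<open>n\<close>; optional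
  sampling again makes \<open>(Y k)\<^sup>+\<close> integrable. The process is thus dominated by the integrable variable
  \<open>\<Sum>k\<le>N. \<bar>Y k\<bar> 1{R k < \<infinity>}\<close>, and dominated convergence along \<open>\<tau> n\<close> finishes the proof.

  The argument is phrased with \<open>Y k\<close> rather than the jumps \<open>J k\<close>, because when several \<open>\<rho> k\<close>
  coincide the individual \<open>J k\<close> need not be integrable.\<close>

section \<open>Positive parts of martingales and optional sampling\<close>

text \<open>Scaling by \<open>c = 1\<close> and \<open>c = - 1\<close> lets estimates for positive
  parts serve for negative parts too.\<close>

lemma martingale_on_cmult:
  assumes "martingale_on M F Z"
  shows "martingale_on M F (\<lambda>t \<omega>. c * Z t \<omega>)"
  unfolding martingale_on_def adapted_on_def
proof (intro conjI allI impI)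
  fix s t A assume "0 \<le> s" "s \<le> t" "A \<in> sets (F s)"
  then have "(LINT \<omega>:A|M. Z t \<omega>) = (LINT \<omega>:A|M. Z s \<omega>)"
    using assms unfolding martingale_on_def by blast
  then show "(LINT \<omega>:A|M. c * Z t \<omega>) = (LINT \<omega>:A|M. c * Z s \<omega>)" by simp
qed (use assms in \<open>auto simp: martingale_on_def adapted_on_def\<close>)

text \<open>\<open>ennreal\<close> sends negative reals to 0, so both integrands are positive parts.
  The part of \<open>A\<close> where \<open>Z s\<close> is positive belongs to \<open>F s\<close>;
  there the martingale identity replaces \<open>Z s\<close> by \<open>Z t\<close>, which is at most
  its positive part.\<close>

lemma martingale_pos_part_le:
  assumes "filtration_on M F" "martingale_on M F Z" "0 \<le> s" "s \<le> t" "A \<in> sets (F s)"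
  shows "(\<integral>\<^sup>+\<omega>. ennreal (Z s \<omega>) * indicator A \<omega> \<partial>M) \<le> (\<integral>\<^sup>+\<omega>. ennreal (Z t \<omega>) * indicator A \<omega> \<partial>M)"
proof -
  have sub: "sets (F s) \<subseteq> sets M" "space (F s) = space M"
    using assms by (auto simp: filtration_on_def)
  have Zs: "Z s \<in> borel_measurable (F s)" and int: "integrable M (Z s)" "integrable M (Z t)"
    using assms by (auto simp: martingale_on_def adapted_on_def)
  define A' where "A' = A \<inter> {\<omega>\<in>space (F s). 0 < Z s \<omega>}"
  have A'F: "A' \<in> sets (F s)"
    unfolding A'_def using Zs assms(5) by measurable
  then have A': "A' \<in> sets M" using sub by auto
  have A: "A \<in> sets M" "A \<subseteq> space M" using sub assms(5) sets.sets_into_space[OF assms(5)] by auto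
  note int' = integrable_mult_indicator[OF A' int(1)] integrable_mult_indicator[OF A' int(2)]
  have "(\<integral>\<^sup>+\<omega>. ennreal (Z s \<omega>) * indicator A \<omega> \<partial>M) = (\<integral>\<^sup>+\<omega>. ennreal (indicator A' \<omega> *\<^sub>R Z s \<omega>) \<partial>M)"
    using A sub by (intro nn_integral_cong) (auto simp: A'_def indicator_def ennreal_neg)
  also have "\<dots> = ennreal (LINT \<omega>:A'|M. Z s \<omega>)"
    unfolding set_lebesgue_integral_def
    by (rule nn_integral_eq_integral[OF int'(1)]) (simp add: A'_def indicator_def)
  also have "(LINT \<omega>:A'|M. Z s \<omega>) = (LINT \<omega>:A'|M. Z t \<omega>)"
    using assms(2-4) A'F unfolding martingale_on_def by metis
  also have "ennreal \<dots> \<le> ennreal (LINT \<omega>|M. max 0 (indicator A' \<omega> *\<^sub>R Z t \<omega>))"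
    unfolding set_lebesgue_integral_def using int'(2) by (intro ennreal_leI integral_mono) simp_all
  also have "\<dots> = (\<integral>\<^sup>+\<omega>. ennreal (max 0 (indicator A' \<omega> *\<^sub>R Z t \<omega>)) \<partial>M)"
    by (rule nn_integral_eq_integral[symmetric]) (use int'(2) in simp_all)
  also have "\<dots> \<le> (\<integral>\<^sup>+\<omega>. ennreal (Z t \<omega>) * indicator A \<omega> \<partial>M)"
    by (intro nn_integral_mono) (auto simp: A'_def indicator_def max_def ennreal_neg)
  finally show ?thesis .
qed

text \<open>Fatou's lemma along discretisations of the stopping time avoids any uniform integrability.\<close>

lemma martingale_pos_part_optional_sampling:
  assumes filt: "filtration_on M F" and mart: "martingale_on M F Z"
    and stop: "stopping_time_on F \<sigma>" and "0 \<le> T"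
    and rc: "\<And>\<omega> t. \<omega> \<in> space M \<Longrightarrow> 0 \<le> t \<Longrightarrow> continuous (at_right t) (\<lambda>s. Z s \<omega>)"
  shows "(\<integral>\<^sup>+\<omega>. ennreal (Z (enn2real (\<sigma> \<omega>)) \<omega>) * indicator {\<omega>\<in>space M. \<sigma> \<omega> \<le> ennreal T} \<omega> \<partial>M)
       \<le> (\<integral>\<^sup>+\<omega>. ennreal (Z T \<omega>) * indicator {\<omega>\<in>space M. \<sigma> \<omega> \<le> ennreal T} \<omega> \<partial>M)"
proof -
  define D where "D = {\<omega>\<in>space M. \<sigma> \<omega> \<le> ennreal T}"
  \<comment> \<open>The points \<open>g i 0\<close>, ..., \<open>g i (Suc i)\<close> divide
    \<open>[0, T]\<close> into \<open>Suc i\<close> equal steps.\<close>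
  define g where "g i j = T * real j / real (Suc i)" for i j :: nat
  have g0: "0 \<le> g i j" for i j using \<open>0 \<le> T\<close> by (simp add: g_def)
  have gT: "g i (Suc i) = T" for i by (simp add: g_def)
  have gle: "g i j \<le> T" if "j \<le> Suc i" for i j
    using mult_left_mono[of "real j" "real (Suc i)" T] that \<open>0 \<le> T\<close> by (simp add: g_def field_simps)
  have gmono: "g i j \<le> g i k" if "j \<le> k" for i j k
    using that \<open>0 \<le> T\<close> by (auto simp: g_def intro!: divide_right_mono mult_left_mono)
  \<comment> \<open>On \<open>E i j\<close> the point \<open>g i j\<close> is
    \<open>\<sigma>\<close> rounded up to the grid. This event is known at time
    \<open>g i j\<close>, so the fixed-time inequality applies on it.\<close>
  define E where "E i j = {\<omega>\<in>space M. \<sigma> \<omega> \<le> ennreal (g i j) \<and> (\<forall>k<j. \<not> \<sigma> \<omega> \<le> ennreal (g i k))}" for i j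
  have spF: "space (F t) = space M" "sets (F t) \<subseteq> sets M" if "0 \<le> t" for t
    using filt that by (auto simp: filtration_on_def)
  have level: "{\<omega>\<in>space M. \<sigma> \<omega> \<le> ennreal s} \<in> sets (F t)" if "0 \<le> s" "s \<le> t" for s t
  proof -
    have "{\<omega>\<in>space (F s). \<sigma> \<omega> \<le> ennreal s} \<in> sets (F s)"
      using stop that by (simp add: stopping_time_on_def)
    moreover have "sets (F s) \<subseteq> sets (F t)" using filt that by (simp add: filtration_on_def)
    ultimately show ?thesis using spF[of s] that by auto
  qed
  have EF: "E i j \<in> sets (F (g i j))" for i j
  proof -
    have "E i j = {\<omega>\<in>space M. \<sigma> \<omega> \<le> ennreal (g i j)} - (\<Union>k<j. {\<omega>\<in>space M. \<sigma> \<omega> \<le> ennreal (g i k)})"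
      by (auto simp: E_def)
    also have "\<dots> \<in> sets (F (g i j))"
      using g0 gmono by (intro sets.Diff sets.finite_UN level) auto
    finally show ?thesis .
  qed
  have EM: "E i j \<in> sets M" for i j using EF spF(2)[OF g0] by blast
  have Zm: "Z t \<in> borel_measurable M" if "0 \<le> t" for t
    using mart that by (auto simp: martingale_on_def)
  \<comment> \<open>\<open>u i\<close> is the positive part of \<open>Z\<close> at the rounded time,
    set to 0 outside \<open>D\<close>.\<close>
  define u where "u i \<omega> = (\<Sum>j\<le>Suc i. ennreal (Z (g i j) \<omega>) * indicator (E i j) \<omega>)" for i \<omega>
  have um: "u i \<in> borel_measurable M" for i
    unfolding u_def using Zm[OF g0] EM by measurable
  have disj: "disjoint_family_on (E i) A" for i A
    unfolding disjoint_family_on_def E_def by (auto dest: linorder_neq_iff[THEN iffD1])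
  have union: "(\<Union>j\<le>Suc i. E i j) = D" for i
  proof (intro equalityI subsetI)
    fix \<omega> assume "\<omega> \<in> (\<Union>j\<le>Suc i. E i j)"
    then obtain j where "j \<le> Suc i" "\<omega> \<in> space M" "\<sigma> \<omega> \<le> ennreal (g i j)" by (auto simp: E_def)
    then show "\<omega> \<in> D" using order_trans[OF _ ennreal_leI[OF gle]] by (auto simp: D_def)
  next
    fix \<omega> assume "\<omega> \<in> D"
    then have "\<omega> \<in> space M" "\<sigma> \<omega> \<le> ennreal (g i (Suc i))" by (auto simp: D_def gT)
    moreover from this obtain j where "\<sigma> \<omega> \<le> ennreal (g i j)" "\<forall>k<j. \<not> \<sigma> \<omega> \<le> ennreal (g i k)"
      using exists_least_iff[of "\<lambda>j. \<sigma> \<omega> \<le> ennreal (g i j)"] by blast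
    moreover from calculation have "j \<le> Suc i" using not_le_imp_less by blast
    ultimately show "\<omega> \<in> (\<Union>j\<le>Suc i. E i j)" by (auto simp: E_def)
  qed
  have indD: "indicator D \<omega> = (\<Sum>j\<le>Suc i. indicator (E i j) \<omega> :: ennreal)" for i \<omega>
    using indicator_UN_disjoint[OF _ disj, of "{..Suc i}" i \<omega>] union by simp
  have ub: "(\<integral>\<^sup>+\<omega>. u i \<omega> \<partial>M) \<le> (\<integral>\<^sup>+\<omega>. ennreal (Z T \<omega>) * indicator D \<omega> \<partial>M)" for i
  proof -
    have "(\<integral>\<^sup>+\<omega>. u i \<omega> \<partial>M) = (\<Sum>j\<le>Suc i. \<integral>\<^sup>+\<omega>. ennreal (Z (g i j) \<omega>) * indicator (E i j) \<omega> \<partial>M)"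
      unfolding u_def using Zm[OF g0] EM by (intro nn_integral_sum) simp
    also have "\<dots> \<le> (\<Sum>j\<le>Suc i. \<integral>\<^sup>+\<omega>. ennreal (Z T \<omega>) * indicator (E i j) \<omega> \<partial>M)"
      using g0 gle EF by (intro sum_mono martingale_pos_part_le[OF filt mart]) auto
    also have "\<dots> = (\<integral>\<^sup>+\<omega>. (\<Sum>j\<le>Suc i. ennreal (Z T \<omega>) * indicator (E i j) \<omega>) \<partial>M)"
      using Zm[OF \<open>0 \<le> T\<close>] EM by (intro nn_integral_sum[symmetric]) simp
    also have "\<dots> = (\<integral>\<^sup>+\<omega>. ennreal (Z T \<omega>) * indicator D \<omega> \<partial>M)"
      unfolding indD[of _ i] sum_distrib_left ..
    finally show ?thesis .
  qed
  have lim: "(\<lambda>i. u i \<omega>) \<longlonglongrightarrow> ennreal (Z (enn2real (\<sigma> \<omega>)) \<omega>)" if "\<omega> \<in> D" for \<omega>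
  proof -
    have \<omega>: "\<omega> \<in> space M" "\<sigma> \<omega> \<le> ennreal T" using that by (auto simp: D_def)
    define r where "r = enn2real (\<sigma> \<omega>)"
    have r: "\<sigma> \<omega> = ennreal r" "0 \<le> r"
      using \<omega> by (auto simp: r_def ennreal_enn2real_if top_unique)
    have "\<exists>j\<le>Suc i. \<omega> \<in> E i j" for i using that union[of i] by blast
    then obtain \<kappa> where \<kappa>: "\<And>i. \<kappa> i \<le> Suc i" "\<And>i. \<omega> \<in> E i (\<kappa> i)" by metis
    have ueq: "u i \<omega> = ennreal (Z (g i (\<kappa> i)) \<omega>)" for i
    proof -
      have "u i \<omega> = (\<Sum>j\<in>{\<kappa> i}. ennreal (Z (g i j) \<omega>) * indicator (E i j) \<omega>)"
        unfolding u_def using \<kappa>(1) disjoint_family_onD[OF disj[of i UNIV] _ _ _, of _ "\<kappa> i"] \<kappa>(2)[of i]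
        by (intro sum.mono_neutral_right) (auto simp: indicator_def)
      then show ?thesis using \<kappa> by simp
    qed
    have lower: "r \<le> g i (\<kappa> i)" for i
      using \<kappa>(2)[of i] r g0 by (auto simp: E_def)
    have upper: "g i (\<kappa> i) \<le> r + T / real (Suc i)" for i
    proof (cases "\<kappa> i")
      case 0
      then show ?thesis using r \<open>0 \<le> T\<close> by (simp add: g_def)
    next
      case (Suc k)
      then have "\<not> r \<le> g i k" using \<kappa>(2)[of i] r g0 by (auto simp: E_def)
      moreover have "g i (Suc k) = g i k + T / real (Suc i)"
        by (simp add: g_def distrib_left add_divide_distrib)
      ultimately show ?thesis using Suc by simp
    qed
    have glim: "(\<lambda>i. g i (\<kappa> i)) \<longlonglongrightarrow> r"
    proof (rule tendsto_sandwich[of "\<lambda>_. r" _ _ "\<lambda>i. r + T / real (Suc i)"])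
      have "(\<lambda>i. r + T * inverse (real (Suc i))) \<longlonglongrightarrow> r + T * 0"
        by (intro tendsto_intros LIMSEQ_inverse_real_of_nat)
      then show "(\<lambda>i. r + T / real (Suc i)) \<longlonglongrightarrow> r" by (simp add: divide_inverse)
    qed (use lower upper in auto)
    \<comment> \<open>Rounding up may return \<open>r\<close> itself, so the limit is taken within
      the closed half-line; approach from the right makes right continuity enough.\<close>
    have "continuous (at r within {r..}) (\<lambda>s. Z s \<omega>)"
      using rc[OF \<omega>(1) r(2)] by (simp add: continuous_within at_within_Ici_at_right)
    then have "(\<lambda>i. Z (g i (\<kappa> i)) \<omega>) \<longlonglongrightarrow> Z r \<omega>"
      by (rule continuous_within_tendsto_compose'[OF _ _ glim]) (simp add: lower)
    then show ?thesis unfolding ueq r_def by (intro tendsto_ennrealI)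
  qed
  have "(\<integral>\<^sup>+\<omega>. ennreal (Z (enn2real (\<sigma> \<omega>)) \<omega>) * indicator D \<omega> \<partial>M) \<le> (\<integral>\<^sup>+\<omega>. liminf (\<lambda>i. u i \<omega>) \<partial>M)"
  proof (intro nn_integral_mono)
    fix \<omega>
    show "ennreal (Z (enn2real (\<sigma> \<omega>)) \<omega>) * indicator D \<omega> \<le> liminf (\<lambda>i. u i \<omega>)"
      using lim_imp_Liminf[OF sequentially_bot lim, of \<omega>] by (auto simp: indicator_def)
  qed
  also have "\<dots> \<le> liminf (\<lambda>i. \<integral>\<^sup>+\<omega>. u i \<omega> \<partial>M)" by (rule nn_integral_liminf[OF um])
  also have "\<dots> \<le> (\<integral>\<^sup>+\<omega>. ennreal (Z T \<omega>) * indicator D \<omega> \<partial>M)"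
    using ub by (intro Liminf_le) auto
  finally show ?thesis unfolding D_def .
qed

section \<open>Cancellation and domination\<close>

lemma borel_measurable_stopping_time_on:
  assumes "filtration_on M F" "stopping_time_on F \<sigma>"
  shows "\<sigma> \<in> borel_measurable M"
proof (rule borel_measurableI_le)
  fix y :: ennreal
  show "{\<omega>\<in>space M. \<sigma> \<omega> \<le> y} \<in> sets M"
  proof (cases y)
    case (real r)
    then have "{\<omega>\<in>space (F r). \<sigma> \<omega> \<le> ennreal r} \<in> sets (F r)"
      using assms by (auto simp: stopping_time_on_def)
    then show ?thesis using assms real by (auto simp: filtration_on_def)
  qed simp
qed

text \<open>The two integrals over \<open>D - G\<close> coincide, and they are finite because
  \<open>b\<close> has finite integral, so they can be subtracted from both sides in
  \<open>ennreal\<close>.\<close>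

lemma nn_integral_le_cancel:
  assumes meas: "D \<in> sets M" "G \<in> sets M" "G \<subseteq> D" "a \<in> borel_measurable M" "b \<in> borel_measurable M"
    and le: "(\<integral>\<^sup>+x. a x * indicator D x \<partial>M) \<le> (\<integral>\<^sup>+x. b x * indicator D x \<partial>M)"
    and eq: "\<And>x. x \<in> D - G \<Longrightarrow> a x = b x"
    and fin: "(\<integral>\<^sup>+x. b x \<partial>M) < \<infinity>"
  shows "(\<integral>\<^sup>+x. a x * indicator G x \<partial>M) \<le> (\<integral>\<^sup>+x. b x * indicator G x \<partial>M)"
proof -
  have split: "(\<integral>\<^sup>+x. f x * indicator D x \<partial>M) =
      (\<integral>\<^sup>+x. f x * indicator (D - G) x \<partial>M) + (\<integral>\<^sup>+x. f x * indicator G x \<partial>M)"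
    if "f \<in> borel_measurable M" for f
  proof -
    have "(\<integral>\<^sup>+x. f x * indicator D x \<partial>M) = (\<integral>\<^sup>+x. f x * indicator (D - G) x + f x * indicator G x \<partial>M)"
      using \<open>G \<subseteq> D\<close> by (intro nn_integral_cong) (auto simp: indicator_def)
    also have "\<dots> = (\<integral>\<^sup>+x. f x * indicator (D - G) x \<partial>M) + (\<integral>\<^sup>+x. f x * indicator G x \<partial>M)"
      using that meas by (intro nn_integral_add) auto
    finally show ?thesis .
  qed
  have "(\<integral>\<^sup>+x. a x * indicator (D - G) x \<partial>M) = (\<integral>\<^sup>+x. b x * indicator (D - G) x \<partial>M)"
    using eq by (intro nn_integral_cong) (auto simp: indicator_def)
  moreover have "(\<integral>\<^sup>+x. b x * indicator (D - G) x \<partial>M) \<le> (\<integral>\<^sup>+x. b x \<partial>M)"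
    by (intro nn_integral_mono) (auto simp: indicator_def)
  ultimately show ?thesis
    using le fin split[OF meas(4)] split[OF meas(5)]
    by (auto simp: ennreal_add_left_cancel_le top_unique less_top[symmetric])
qed

text \<open>If \<open>X t\<close> exceeds \<open>n\<close> in absolute value, so does
  \<open>H\<close>; hence the tail integrals of \<open>H\<close>, which tend to 0, bound those of
  \<open>X t\<close> uniformly in \<open>t\<close>.\<close>

lemma uniformly_integrable_on_dominated:
  assumes H: "integrable M H"
    and X: "\<And>t. 0 \<le> t \<Longrightarrow> X t \<in> borel_measurable M"
    and le: "\<And>t \<omega>. 0 \<le> t \<Longrightarrow> \<omega> \<in> space M \<Longrightarrow> \<bar>X t \<omega>\<bar> \<le> H \<omega>"
  shows "uniformly_integrable_on M X"
  unfolding uniformly_integrable_on_def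
proof (intro conjI allI impI)
  have int: "integrable M (X t)" if "0 \<le> t" for t
    using H X[OF that] le[OF that]
    by (intro Bochner_Integration.integrable_bound[OF H]) (auto intro!: AE_I2 order_trans[OF _ abs_ge_self])
  then show "integrable M (X t)" if "0 \<le> t" for t using that .
  fix e :: real assume "0 < e"
  have Hm: "H \<in> borel_measurable M" using H by simp
  have "(\<lambda>n. LINT \<omega>|M. indicator {\<omega>\<in>space M. real n < H \<omega>} \<omega> *\<^sub>R H \<omega>) \<longlonglongrightarrow> (LINT \<omega>|M. 0)"
  proof (rule integral_dominated_convergence)
    show "integrable M (\<lambda>\<omega>. \<bar>H \<omega>\<bar>)" using H by simp
    show "AE \<omega> in M. (\<lambda>n. indicator {\<omega>\<in>space M. real n < H \<omega>} \<omega> *\<^sub>R H \<omega>) \<longlonglongrightarrow> 0"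
    proof (intro AE_I2 tendsto_eventually)
      fix \<omega>
      show "\<forall>\<^sub>F n in sequentially. indicator {\<omega>\<in>space M. real n < H \<omega>} \<omega> *\<^sub>R H \<omega> = 0"
        using eventually_ge_at_top[of "nat \<lceil>H \<omega>\<rceil>"] by eventually_elim (auto simp: indicator_def)
    qed
  qed (use Hm in \<open>auto simp: indicator_def\<close>)
  then have "(\<lambda>n. LINT \<omega>|M. indicator {\<omega>\<in>space M. real n < H \<omega>} \<omega> *\<^sub>R H \<omega>) \<longlonglongrightarrow> 0" by simp
  from order_tendstoD(2)[OF this \<open>0 < e\<close>]
  obtain n where n: "(LINT \<omega>|M. indicator {\<omega>\<in>space M. real n < H \<omega>} \<omega> *\<^sub>R H \<omega>) < e"
    unfolding eventually_sequentially by blast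
  have "(LINT \<omega>:{\<omega>\<in>space M. real n < \<bar>X t \<omega>\<bar>}|M. \<bar>X t \<omega>\<bar>) \<le> e" if "0 \<le> t" for t
  proof -
    have "(LINT \<omega>:{\<omega>\<in>space M. real n < \<bar>X t \<omega>\<bar>}|M. \<bar>X t \<omega>\<bar>)
        \<le> (LINT \<omega>|M. indicator {\<omega>\<in>space M. real n < H \<omega>} \<omega> *\<^sub>R H \<omega>)"
      unfolding set_lebesgue_integral_def
    proof (rule integral_mono)
      show "integrable M (\<lambda>\<omega>. indicator {\<omega>\<in>space M. real n < \<bar>X t \<omega>\<bar>} \<omega> *\<^sub>R \<bar>X t \<omega>\<bar>)"
        using int[OF that] X[OF that] by (intro integrable_mult_indicator) auto
      show "integrable M (\<lambda>\<omega>. indicator {\<omega>\<in>space M. real n < H \<omega>} \<omega> *\<^sub>R H \<omega>)"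
        using H Hm by (intro integrable_mult_indicator) auto
      show "indicator {\<omega>\<in>space M. real n < \<bar>X t \<omega>\<bar>} \<omega> *\<^sub>R \<bar>X t \<omega>\<bar>
          \<le> indicator {\<omega>\<in>space M. real n < H \<omega>} \<omega> *\<^sub>R H \<omega>" if "\<omega> \<in> space M" for \<omega>
        using le[OF \<open>0 \<le> t\<close> that] by (auto simp: indicator_def)
    qed
    then show ?thesis using n by simp
  qed
  then show "\<exists>K. \<forall>t\<ge>0. (LINT \<omega>:{\<omega>\<in>space M. K < \<bar>X t \<omega>\<bar>}|M. \<bar>X t \<omega>\<bar>) \<le> e" by blast
qed

text \<open>Both sides of the martingale identity pass to the limit by dominated convergence with
  the common bound \<open>H\<close>.\<close>

lemma martingale_on_dominated_limit:
  assumes filt: "filtration_on M F"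
    and Z: "\<And>n. martingale_on M F (Z n)"
    and X: "adapted_on F X"
    and lim: "\<And>t. 0 \<le> t \<Longrightarrow> AE \<omega> in M. (\<lambda>n. Z n t \<omega>) \<longlonglongrightarrow> X t \<omega>"
    and H: "integrable M H"
    and le: "\<And>n t \<omega>. 0 \<le> t \<Longrightarrow> \<omega> \<in> space M \<Longrightarrow> \<bar>Z n t \<omega>\<bar> \<le> H \<omega>"
  shows "martingale_on M F X"
proof -
  have F: "sets (F t) \<subseteq> sets M" "space (F t) = space M" if "0 \<le> t" for t
    using filt that by (auto simp: filtration_on_def)
  have Xm: "X t \<in> borel_measurable M" if "0 \<le> t" for t
  proof (rule measurable_mono[THEN subsetD, of borel borel])
    show "X t \<in> borel_measurable (F t)" using X that by (simp add: adapted_on_def)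
  qed (use F[OF that] in auto)
  have Zm: "Z n t \<in> borel_measurable M" if "0 \<le> t" for n t
    using Z[of n] that by (auto simp: martingale_on_def)
  have int: "integrable M (X t)" if "0 \<le> t" for t
  proof (rule integrable_dominated_convergence[OF Xm[OF that] Zm[OF that] H lim[OF that]])
    show "AE \<omega> in M. norm (Z n t \<omega>) \<le> H \<omega>" for n using le[OF that] by auto
  qed
  have conv: "(\<lambda>n. LINT \<omega>:A|M. Z n t \<omega>) \<longlonglongrightarrow> (LINT \<omega>:A|M. X t \<omega>)" if "0 \<le> t" "A \<in> sets M" for A t
    unfolding set_lebesgue_integral_def
  proof (rule integral_dominated_convergence[OF _ _ H])
    show "AE \<omega> in M. (\<lambda>n. indicator A \<omega> *\<^sub>R Z n t \<omega>) \<longlonglongrightarrow> indicator A \<omega> *\<^sub>R X t \<omega>"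
      using lim[OF that(1)] by eventually_elim (intro tendsto_intros)
    show "AE \<omega> in M. norm (indicator A \<omega> *\<^sub>R Z n t \<omega>) \<le> H \<omega>" for n
      using le[OF that(1)] by (intro AE_I2) (force simp: indicator_def)
  qed (use Xm[OF that(1)] Zm[OF that(1)] that(2) in auto)
  have "(LINT \<omega>:A|M. X t \<omega>) = (LINT \<omega>:A|M. X s \<omega>)" if "0 \<le> s" "s \<le> t" "A \<in> sets (F s)" for s t A
  proof (rule LIMSEQ_unique[OF conv])
    have "(LINT \<omega>:A|M. Z n t \<omega>) = (LINT \<omega>:A|M. Z n s \<omega>)" for n
      using Z[of n] that unfolding martingale_on_def by blast
    then show "(\<lambda>n. LINT \<omega>:A|M. Z n t \<omega>) \<longlonglongrightarrow> (LINT \<omega>:A|M. X s \<omega>)"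
      using conv[of s A] that F(1)[of s] by auto
  qed (use that F(1)[of s] in auto)
  then show ?thesis unfolding martingale_on_def using X int by blast
qed

text \<open>Since \<open>t\<close> is finite, so is the minimum, and \<open>enn2real\<close> is
  never applied to infinity.\<close>

lemma stopped_process_eq:
  assumes "0 \<le> t"
  shows "stopped_process X \<tau> t \<omega> = X (enn2real (min (ennreal t) (\<tau> \<omega>))) \<omega>"
  using assms by (auto simp: stopped_process_def min_def)

section \<open>Local martingales with finitely many constant pieces\<close>

text \<open>Paths enter through their constancy from \<open>R k\<close> up to
  \<open>R (Suc k)\<close>. With \<open>R 0 = 0\<close> and \<open>R k\<close> infinite for
  \<open>k > N\<close>, the pieces with \<open>k \<le> N\<close> cover all times.\<close>

locale piecewise_constant_local_martingale = prob_space M for M :: "'a measure" +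
  fixes F :: "real \<Rightarrow> 'a measure" and R :: "nat \<Rightarrow> 'a \<Rightarrow> ennreal" and N :: nat
    and X :: "real \<Rightarrow> 'a \<Rightarrow> real" and \<tau> :: "nat \<Rightarrow> 'a \<Rightarrow> ennreal"
  assumes filtration: "filtration_on M F"
    and stopping_time_R: "stopping_time_on F (R k)"
    and R_0: "\<omega> \<in> space M \<Longrightarrow> R 0 \<omega> = 0"
    and R_Suc: "\<omega> \<in> space M \<Longrightarrow> R k \<omega> \<le> R (Suc k) \<omega>"
    and R_eq_infinity: "\<omega> \<in> space M \<Longrightarrow> N < k \<Longrightarrow> R k \<omega> = \<infinity>"
    and X_constant: "\<omega> \<in> space M \<Longrightarrow> 0 \<le> t \<Longrightarrow> R k \<omega> \<le> ennreal t \<Longrightarrow> ennreal t < R (Suc k) \<omega>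
      \<Longrightarrow> X t \<omega> = X (enn2real (R k \<omega>)) \<omega>"
    and measurable_X_R: "(\<lambda>\<omega>. X (enn2real (R k \<omega>)) \<omega>) \<in> borel_measurable M"
    and adapted: "adapted_on F X"
    and stopping_time_\<tau>: "stopping_time_on F (\<tau> n)"
    and \<tau>_tendsto: "AE \<omega> in M. (\<lambda>n. \<tau> n \<omega>) \<longlonglongrightarrow> \<infinity>"
    and martingale_stopped: "martingale_on M F (stopped_process X (\<tau> n))"
begin

text \<open>Where \<open>R k\<close> is infinite, \<open>enn2real\<close> returns 0 and
  \<open>Y k\<close> is just \<open>X 0\<close>; this is why integrals of \<open>Y k\<close> are
  restricted to \<open>fin k\<close> or smaller sets.\<close>

definition Y :: "nat \<Rightarrow> 'a \<Rightarrow> real" where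
  "Y k \<omega> = X (enn2real (R k \<omega>)) \<omega>"

text \<open>One index \<open>n\<close> serves as time horizon and as localizing index, so that a
  single limit removes both restrictions.\<close>

definition Z :: "nat \<Rightarrow> 'a \<Rightarrow> real" where
  "Z n = stopped_process X (\<tau> n) (real n)"

definition B :: "nat \<Rightarrow> nat \<Rightarrow> 'a set" where
  "B n k = {\<omega>\<in>space M. R k \<omega> \<le> min (ennreal (real n)) (\<tau> n \<omega>)}"

definition fin :: "nat \<Rightarrow> 'a set" where
  "fin k = {\<omega>\<in>space M. R k \<omega> < \<infinity>}"

lemma measurable_R [measurable]: "R k \<in> borel_measurable M"
  by (rule borel_measurable_stopping_time_on[OF filtration stopping_time_R])

lemma measurable_\<tau> [measurable]: "\<tau> n \<in> borel_measurable M"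
  by (rule borel_measurable_stopping_time_on[OF filtration stopping_time_\<tau>])

lemma measurable_Y [measurable]: "Y k \<in> borel_measurable M"
  unfolding Y_def by (rule measurable_X_R)

lemma integrable_Z: "integrable M (Z n)"
  using martingale_stopped[of n] by (simp add: Z_def martingale_on_def)

lemma measurable_Z [measurable]: "Z n \<in> borel_measurable M"
  using integrable_Z by simp

lemma sets_B [measurable]: "B n k \<in> sets M"
  unfolding B_def by measurable

lemma sets_fin [measurable]: "fin k \<in> sets M"
  unfolding fin_def by measurable

lemma R_mono: "\<omega> \<in> space M \<Longrightarrow> i \<le> j \<Longrightarrow> R i \<omega> \<le> R j \<omega>"
  using lift_Suc_mono_le[of "\<lambda>k. R k \<omega>"] R_Suc by blast

text \<open>The least \<open>k\<close> with \<open>t < R (Suc k)\<close> works: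
  \<open>R (Suc N)\<close> is infinite, so \<open>k \<le> N\<close>, and minimality together with
  \<open>R 0 = 0\<close> gives \<open>R k \<le> t\<close>. Coinciding stopping times only produce
  empty pieces, which are skipped.\<close>

lemma position:
  assumes "\<omega> \<in> space M" "0 \<le> t"
  obtains k where "k \<le> N" "R k \<omega> \<le> ennreal t" "ennreal t < R (Suc k) \<omega>"
    "X t \<omega> = Y k \<omega>" "\<omega> \<in> fin k"
proof -
  have "ennreal t < R (Suc N) \<omega>" using R_eq_infinity[OF assms(1)] by simp
  moreover from this obtain k where k: "ennreal t < R (Suc k) \<omega>" "\<forall>j<k. \<not> ennreal t < R (Suc j) \<omega>"
    using exists_least_iff[of "\<lambda>k. ennreal t < R (Suc k) \<omega>"] by blast
  ultimately have kN: "k \<le> N" using not_le_imp_less by blast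
  have R: "R k \<omega> \<le> ennreal t"
    using k(2) R_0[OF assms(1)] by (cases k) (auto simp: not_less)
  then have "R k \<omega> < \<infinity>" by (metis ennreal_less_top infinity_ennreal_def order_le_less_trans)
  then show thesis
    using that kN k(1) R X_constant[OF assms R k(1)] assms(1) by (simp add: Y_def fin_def)
qed

lemma stopped_position:
  assumes "\<omega> \<in> space M" "0 \<le> t"
  obtains k where "k \<le> N" "R k \<omega> \<le> min (ennreal t) (\<tau> n \<omega>)" "min (ennreal t) (\<tau> n \<omega>) < R (Suc k) \<omega>"
    "stopped_process X (\<tau> n) t \<omega> = Y k \<omega>" "\<omega> \<in> fin k"
proof -
  have "min (ennreal t) (\<tau> n \<omega>) < \<top>" by (simp add: min_less_iff_disj)
  then have "ennreal (enn2real (min (ennreal t) (\<tau> n \<omega>))) = min (ennreal t) (\<tau> n \<omega>)" by simp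
  with position[OF assms(1), of "enn2real (min (ennreal t) (\<tau> n \<omega>))"] show thesis
    using that stopped_process_eq[OF assms(2), of X "\<tau> n" \<omega>] by (metis enn2real_nonneg)
qed

text \<open>Before \<open>\<tau> n\<close> the path keeps its value until \<open>R (Suc k)\<close>;
  from \<open>\<tau> n\<close> on it is frozen. Either way it is constant just to the right of
  \<open>t\<close>.\<close>

lemma right_continuous_stopped:
  assumes "\<omega> \<in> space M" "0 \<le> t"
  shows "continuous (at_right t) (\<lambda>s. stopped_process X (\<tau> n) s \<omega>)"
proof -
  have "\<forall>\<^sub>F s in at_right t. stopped_process X (\<tau> n) s \<omega> = stopped_process X (\<tau> n) t \<omega>"
  proof (cases "ennreal t < \<tau> n \<omega>")
    case True
    obtain k where k: "R k \<omega> \<le> ennreal t" "ennreal t < R (Suc k) \<omega>" "X t \<omega> = Y k \<omega>"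
      using position[OF assms] .
    \<comment> \<open>A point strictly below the minimum is finite even when \<open>\<tau> n\<close>
      and \<open>R (Suc k)\<close> are both infinite.\<close>
    then obtain c where c: "ennreal t < c" "c < min (\<tau> n \<omega>) (R (Suc k) \<omega>)"
      using True dense[of "ennreal t" "min (\<tau> n \<omega>) (R (Suc k) \<omega>)"] by auto
    then have "c < \<top>" using top.not_eq_extremum by fastforce
    then obtain b where b: "c = ennreal b" "0 \<le> b" by (cases c) auto
    have "t < b" using c b assms by (simp add: ennreal_less_iff)
    then show ?thesis
    proof (rule eventually_at_rightI[rotated])
      fix s assume s: "s \<in> {t<..<b}"
      then have "ennreal s \<le> ennreal b" by (simp add: ennreal_leI)
      then have *: "ennreal s < \<tau> n \<omega>" "ennreal s < R (Suc k) \<omega>"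
        using order_le_less_trans[OF \<open>ennreal s \<le> ennreal b\<close>] c b by auto
      have "R k \<omega> \<le> ennreal s" using k(1) s by (meson ennreal_leI greaterThanLessThan_iff less_imp_le order_trans)
      then have "X s \<omega> = Y k \<omega>" using X_constant[OF assms(1), of s k] * s assms by (simp add: Y_def)
      then show "stopped_process X (\<tau> n) s \<omega> = stopped_process X (\<tau> n) t \<omega>"
        using less_imp_le[OF *(1)] less_imp_le[OF True] k(3) by (simp add: stopped_process_def)
    qed
  next
    case False
    show ?thesis
    proof (rule eventually_at_rightI[of t "t + 1"])
      fix s assume s: "s \<in> {t<..<t+1}"
      then have "ennreal t \<le> ennreal s" by (simp add: ennreal_leI)
      then have "min (ennreal s) (\<tau> n \<omega>) = min (ennreal t) (\<tau> n \<omega>)" using False by (auto simp: min_def)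
      then show "stopped_process X (\<tau> n) s \<omega> = stopped_process X (\<tau> n) t \<omega>"
        using s assms by (simp add: stopped_process_eq)
    qed simp
  qed
  then show ?thesis by (simp add: continuous_within tendsto_eventually)
qed

text \<open>The last clause is what lets the backward induction run: on \<open>B n (Suc k)\<close>
  only values \<open>Y j\<close> with \<open>j > k\<close> can occur.\<close>

lemma Z_position:
  assumes "\<omega> \<in> space M"
  obtains j where "j \<le> N" "\<omega> \<in> fin j" "Z n \<omega> = Y j \<omega>" "\<And>k. \<omega> \<in> B n k \<Longrightarrow> k \<le> j"
proof -
  obtain j where j: "j \<le> N" "\<omega> \<in> fin j" "Z n \<omega> = Y j \<omega>"
    "min (ennreal (real n)) (\<tau> n \<omega>) < R (Suc j) \<omega>"
    using stopped_position[OF assms, of "real n" n] unfolding Z_def by (metis of_nat_0_le_iff)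
  have "k \<le> j" if "\<omega> \<in> B n k" for k
  proof (rule ccontr)
    assume "\<not> k \<le> j"
    then have "R (Suc j) \<omega> \<le> R k \<omega>" by (intro R_mono[OF assms]) simp
    also have "\<dots> \<le> min (ennreal (real n)) (\<tau> n \<omega>)" using that by (simp add: B_def)
    finally show False using j(4) leD by blast
  qed
  with j show thesis using that by blast
qed

text \<open>Off \<open>G\<close> the two sides of optional sampling at \<open>R k\<close> agree, because there the
  process does not move between \<open>R k\<close> and time \<open>n\<close>.\<close>

lemma Y_part_le:
  assumes G: "G \<in> sets M" "B n (Suc k) \<subseteq> G" "G \<subseteq> B n k"
  shows "(\<integral>\<^sup>+\<omega>. ennreal (c * Y k \<omega>) * indicator G \<omega> \<partial>M)
       \<le> (\<integral>\<^sup>+\<omega>. ennreal (c * Z n \<omega>) * indicator G \<omega> \<partial>M)"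
proof -
  define D where "D = {\<omega>\<in>space M. R k \<omega> \<le> ennreal (real n)}"
  have D: "D \<in> sets M" unfolding D_def by measurable
  have GD: "G \<subseteq> D" using G(3) by (auto simp: B_def D_def)
  define b where "b \<omega> = ennreal (c * Z n \<omega>)" for \<omega>
  \<comment> \<open>By \<open>a_eq\<close>, on \<open>D\<close> this is the positive part of
    \<open>c\<close> times the stopped process at time \<open>R k\<close>. Writing it with
    \<open>b\<close> off \<open>G\<close> makes the equality required for cancellation on
    \<open>D - G\<close> immediate.\<close>
  define a where "a \<omega> = (if \<omega> \<in> G then ennreal (c * Y k \<omega>) else b \<omega>)" for \<omega>
  have bm: "b \<in> borel_measurable M" unfolding b_def by measurable
  have am: "a \<in> borel_measurable M" unfolding a_def using bm G(1) by measurable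
  have a_eq: "a \<omega> = ennreal (c * stopped_process X (\<tau> n) (enn2real (R k \<omega>)) \<omega>)" if "\<omega> \<in> D" for \<omega>
  proof -
    have \<omega>: "\<omega> \<in> space M" "R k \<omega> \<le> ennreal (real n)" using that by (auto simp: D_def)
    then have Rk: "ennreal (enn2real (R k \<omega>)) = R k \<omega>"
      using ennreal_enn2real order_le_less_trans ennreal_less_top by blast
    have st: "stopped_process X (\<tau> n) (enn2real (R k \<omega>)) \<omega> = X (enn2real (min (R k \<omega>) (\<tau> n \<omega>))) \<omega>"
      using Rk by (simp add: stopped_process_eq)
    have Zn: "Z n \<omega> = X (enn2real (min (ennreal (real n)) (\<tau> n \<omega>))) \<omega>"
      by (simp add: Z_def stopped_process_eq)
    show ?thesis
    proof (cases "\<omega> \<in> G")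
      case True
      then have "R k \<omega> \<le> \<tau> n \<omega>" using G(3) by (auto simp: B_def)
      then show ?thesis using True st by (simp add: a_def Y_def min_absorb1)
    next
      case False
      then have nB: "\<omega> \<notin> B n (Suc k)" using G(2) by auto
      \<comment> \<open>If \<open>R k \<le> \<tau> n\<close>, then being outside
        \<open>B n (Suc k)\<close> puts the minimum of \<open>n\<close> and \<open>\<tau> n\<close>
        before \<open>R (Suc k)\<close>, still in the piece of \<open>Y k\<close>. Otherwise both
        sides are the value at \<open>\<tau> n\<close>.\<close>
      have "Z n \<omega> = stopped_process X (\<tau> n) (enn2real (R k \<omega>)) \<omega>"
      proof (cases "R k \<omega> \<le> \<tau> n \<omega>")
        case True
        define m where "m = min (ennreal (real n)) (\<tau> n \<omega>)"
        have "m < \<top>" unfolding m_def by (simp add: min_less_iff_disj)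
        then have m: "ennreal (enn2real m) = m" by simp
        have "X (enn2real m) \<omega> = Y k \<omega>"
          unfolding Y_def
        proof (rule X_constant[OF \<omega>(1)])
          show "R k \<omega> \<le> ennreal (enn2real m)" using True \<omega>(2) unfolding m by (simp add: m_def)
          show "ennreal (enn2real m) < R (Suc k) \<omega>"
            using nB \<omega>(1) unfolding m not_le[symmetric] by (simp add: m_def B_def)
        qed simp
        then show ?thesis using True st Zn by (simp add: m_def Y_def min_absorb1)
      next
        case False
        then have "\<tau> n \<omega> \<le> R k \<omega>" "\<tau> n \<omega> \<le> ennreal (real n)" using \<omega>(2) by auto
        then show ?thesis unfolding st Zn by (simp add: min_absorb2)
      qed
      then show ?thesis using False by (simp add: a_def b_def)
    qed
  qed
  have "(\<integral>\<^sup>+\<omega>. a \<omega> * indicator D \<omega> \<partial>M) = (\<integral>\<^sup>+\<omega>. ennreal (c * stopped_process X (\<tau> n) (enn2real (R k \<omega>)) \<omega>) * indicator D \<omega> \<partial>M)"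
    using a_eq by (intro nn_integral_cong) (auto simp: indicator_def)
  also have "\<dots> \<le> (\<integral>\<^sup>+\<omega>. b \<omega> * indicator D \<omega> \<partial>M)"
    unfolding D_def b_def Z_def
    by (rule martingale_pos_part_optional_sampling[OF filtration martingale_on_cmult[OF martingale_stopped] stopping_time_R])
      (simp_all add: continuous_mult_left right_continuous_stopped)
  finally have le: "(\<integral>\<^sup>+\<omega>. a \<omega> * indicator D \<omega> \<partial>M) \<le> (\<integral>\<^sup>+\<omega>. b \<omega> * indicator D \<omega> \<partial>M)" .
  have "integrable M (\<lambda>\<omega>. c * Z n \<omega>)" using integrable_Z by simp
  then have "(\<integral>\<^sup>+\<omega>. ennreal (norm (c * Z n \<omega>)) \<partial>M) < \<infinity>" by (simp only: integrable_iff_bounded)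
  moreover have "(\<integral>\<^sup>+\<omega>. b \<omega> \<partial>M) \<le> (\<integral>\<^sup>+\<omega>. ennreal (norm (c * Z n \<omega>)) \<partial>M)"
    unfolding b_def by (intro nn_integral_mono ennreal_leI) simp
  ultimately have "(\<integral>\<^sup>+\<omega>. b \<omega> \<partial>M) < \<infinity>" by simp
  from nn_integral_le_cancel[OF D G(1) GD am bm le _ this]
  have "(\<integral>\<^sup>+\<omega>. a \<omega> * indicator G \<omega> \<partial>M) \<le> (\<integral>\<^sup>+\<omega>. b \<omega> * indicator G \<omega> \<partial>M)"
    by (simp add: a_def)
  moreover have "(\<integral>\<^sup>+\<omega>. a \<omega> * indicator G \<omega> \<partial>M) = (\<integral>\<^sup>+\<omega>. ennreal (c * Y k \<omega>) * indicator G \<omega> \<partial>M)"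
    by (intro nn_integral_cong) (auto simp: a_def indicator_def)
  ultimately show ?thesis by (simp add: b_def)
qed

lemma B_Suc_subset: "B n (Suc k) \<subseteq> B n k"
  using R_Suc by (auto simp: B_def intro: order_trans)

section \<open>Integrability of the negative and positive parts\<close>

text \<open>Almost every point of \<open>fin k\<close> lies in \<open>B n k\<close> for all large
  \<open>n\<close>, since \<open>n\<close> and \<open>\<tau> n\<close> both pass the finite value
  \<open>R k\<close>; Fatou's lemma then transfers the bound.\<close>

lemma nn_integral_fin_le:
  assumes g [measurable]: "g \<in> borel_measurable M"
    and le: "\<And>n. (\<integral>\<^sup>+\<omega>. g \<omega> * indicator (B n k) \<omega> \<partial>M) \<le> C"
  shows "(\<integral>\<^sup>+\<omega>. g \<omega> * indicator (fin k) \<omega> \<partial>M) \<le> C"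
proof -
  have "(\<integral>\<^sup>+\<omega>. g \<omega> * indicator (fin k) \<omega> \<partial>M) \<le> (\<integral>\<^sup>+\<omega>. liminf (\<lambda>n. g \<omega> * indicator (B n k) \<omega>) \<partial>M)"
  proof (rule nn_integral_mono_AE)
    show "AE \<omega> in M. g \<omega> * indicator (fin k) \<omega> \<le> liminf (\<lambda>n. g \<omega> * indicator (B n k) \<omega>)"
      using \<tau>_tendsto AE_space
    proof eventually_elim
      fix \<omega> assume lim: "(\<lambda>n. \<tau> n \<omega>) \<longlonglongrightarrow> \<infinity>" and \<omega>: "\<omega> \<in> space M"
      show "g \<omega> * indicator (fin k) \<omega> \<le> liminf (\<lambda>n. g \<omega> * indicator (B n k) \<omega>)"
      proof (cases "\<omega> \<in> fin k")
        case True
        then have "R k \<omega> < \<infinity>" by (simp add: fin_def)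
        then obtain r where r: "R k \<omega> = ennreal r" "0 \<le> r" by (cases "R k \<omega>") auto
        have "\<forall>\<^sub>F n in sequentially. R k \<omega> < \<tau> n \<omega>"
          by (rule order_tendstoD(1)[OF lim \<open>R k \<omega> < \<infinity>\<close>])
        then have "\<forall>\<^sub>F n in sequentially. \<omega> \<in> B n k"
          using eventually_ge_at_top[of "nat \<lceil>r\<rceil>"]
        proof eventually_elim
          case (elim n)
          then have "ennreal r \<le> ennreal (real n)" by (intro ennreal_leI) linarith
          then show ?case using elim \<omega> r by (auto simp: B_def)
        qed
        then show ?thesis
          by (intro Liminf_bounded, elim eventually_mono) (simp add: True)
      qed simp
    qed
  qed
  also have "\<dots> \<le> liminf (\<lambda>n. \<integral>\<^sup>+\<omega>. g \<omega> * indicator (B n k) \<omega> \<partial>M)"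
    by (intro nn_integral_liminf) measurable
  also have "\<dots> \<le> C" using le by (intro Liminf_le) auto
  finally show ?thesis .
qed

text \<open>\<open>Z n\<close> equals a single \<open>Y j\<close> with
  \<open>k \<le> j \<le> N\<close> on \<open>fin j\<close>. Summing over all candidates gives a
  bound free of \<open>n\<close>.\<close>

lemma Z_part_le:
  assumes "\<omega> \<in> space M" "\<omega> \<in> B n k"
  shows "ennreal (c * Z n \<omega>) \<le> (\<Sum>j\<in>{k..N}. ennreal (c * Y j \<omega>) * indicator (fin j) \<omega>)"
proof -
  obtain j where j: "j \<le> N" "\<omega> \<in> fin j" "Z n \<omega> = Y j \<omega>" "k \<le> j"
    using Z_position[OF assms(1), of n] assms(2) by metis
  have "ennreal (c * Z n \<omega>) = (\<Sum>j\<in>{j}. ennreal (c * Y j \<omega>) * indicator (fin j) \<omega>)" using j by simp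
  also have "\<dots> \<le> (\<Sum>j\<in>{k..N}. ennreal (c * Y j \<omega>) * indicator (fin j) \<omega>)"
    using j by (intro sum_mono2) auto
  finally show ?thesis .
qed

lemma nn_integral_Z_le:
  "(\<integral>\<^sup>+\<omega>. ennreal (c * Z n \<omega>) * indicator (B n k) \<omega> \<partial>M)
    \<le> (\<Sum>j\<in>{k..N}. \<integral>\<^sup>+\<omega>. ennreal (c * Y j \<omega>) * indicator (fin j) \<omega> \<partial>M)"
proof -
  have "(\<integral>\<^sup>+\<omega>. ennreal (c * Z n \<omega>) * indicator (B n k) \<omega> \<partial>M)
      \<le> (\<integral>\<^sup>+\<omega>. (\<Sum>j\<in>{k..N}. ennreal (c * Y j \<omega>) * indicator (fin j) \<omega>) \<partial>M)"
    using Z_part_le by (intro nn_integral_mono) (auto simp: indicator_def)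
  also have "\<dots> = (\<Sum>j\<in>{k..N}. \<integral>\<^sup>+\<omega>. ennreal (c * Y j \<omega>) * indicator (fin j) \<omega> \<partial>M)"
    by (intro nn_integral_sum) measurable
  finally show ?thesis .
qed

lemma B_0: "B n 0 = space M"
  using R_0 by (auto simp: B_def)

lemma neg_part_finite:
  assumes fin: "(\<integral>\<^sup>+ \<omega>. Liminf at_top (\<lambda>t. ennreal (- X t \<omega>)) \<partial>M) < \<infinity>" and "k \<le> N"
  shows "(\<integral>\<^sup>+\<omega>. ennreal (- Y k \<omega>) * indicator (fin k) \<omega> \<partial>M) < \<infinity>"
  using \<open>k \<le> N\<close>
proof (induction "N - k" arbitrary: k rule: less_induct)
  case less
  \<comment> \<open>For \<open>k = N\<close> this sum is empty, so the base case needs no separate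
    treatment.\<close>
  let ?C = "\<Sum>j\<in>{Suc k..N}. \<integral>\<^sup>+\<omega>. ennreal (- 1 * Y j \<omega>) * indicator (fin j) \<omega> \<partial>M"
  have C: "?C < \<infinity>" using less by (auto simp: ennreal_sum_less_top)
  \<comment> \<open>Here \<open>Y_part_le\<close> is used with the smallest admissible set,
    \<open>G = B n (Suc k)\<close>, to keep \<open>Y k\<close> itself out of the bound.\<close>
  have "(\<integral>\<^sup>+\<omega>. ennreal (- 1 * Y k \<omega>) * indicator (B n (Suc k)) \<omega> \<partial>M) \<le> ?C" for n
    by (rule order_trans[OF Y_part_le nn_integral_Z_le]) (use B_Suc_subset in auto)
  then have 1: "(\<integral>\<^sup>+\<omega>. ennreal (- 1 * Y k \<omega>) * indicator (fin (Suc k)) \<omega> \<partial>M) \<le> ?C"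
    by (intro nn_integral_fin_le) measurable
  \<comment> \<open>With no further finite \<open>R (Suc k)\<close>, the path stays at
    \<open>Y k\<close> from \<open>R k\<close> on, so the lower limit is at least the negative part
    of \<open>Y k\<close>.\<close>
  have 2: "(\<integral>\<^sup>+\<omega>. ennreal (- 1 * Y k \<omega>) * indicator (fin k - fin (Suc k)) \<omega> \<partial>M)
      \<le> (\<integral>\<^sup>+ \<omega>. Liminf at_top (\<lambda>t. ennreal (- X t \<omega>)) \<partial>M)"
  proof (intro nn_integral_mono)
    fix \<omega>
    show "ennreal (- 1 * Y k \<omega>) * indicator (fin k - fin (Suc k)) \<omega> \<le> Liminf at_top (\<lambda>t. ennreal (- X t \<omega>))"
    proof (cases "\<omega> \<in> fin k - fin (Suc k)")
      case True
      then have \<omega>: "\<omega> \<in> space M" "R k \<omega> < \<infinity>" "R (Suc k) \<omega> = \<infinity>" by (auto simp: fin_def less_top[symmetric])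
      then obtain r where r: "R k \<omega> = ennreal r" "0 \<le> r" by (cases "R k \<omega>") auto
      have "\<forall>\<^sub>F t in at_top. X t \<omega> = Y k \<omega>"
        using eventually_ge_at_top[of r]
      proof eventually_elim
        case (elim t)
        then show ?case
          unfolding Y_def using r \<omega> by (intro X_constant) (auto simp: ennreal_leI)
      qed
      then have "ennreal (- Y k \<omega>) \<le> Liminf at_top (\<lambda>t. ennreal (- X t \<omega>))"
        by (intro Liminf_bounded) (auto elim!: eventually_mono)
      then show ?thesis using True by simp
    qed simp
  qed
  have "(\<integral>\<^sup>+\<omega>. ennreal (- Y k \<omega>) * indicator (fin k) \<omega> \<partial>M)
      \<le> (\<integral>\<^sup>+\<omega>. ennreal (- 1 * Y k \<omega>) * indicator (fin (Suc k)) \<omega>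
            + ennreal (- 1 * Y k \<omega>) * indicator (fin k - fin (Suc k)) \<omega> \<partial>M)"
    by (intro nn_integral_mono) (auto simp: indicator_def)
  also have "\<dots> = (\<integral>\<^sup>+\<omega>. ennreal (- 1 * Y k \<omega>) * indicator (fin (Suc k)) \<omega> \<partial>M)
            + (\<integral>\<^sup>+\<omega>. ennreal (- 1 * Y k \<omega>) * indicator (fin k - fin (Suc k)) \<omega> \<partial>M)"
    by (intro nn_integral_add) auto
  also have "\<dots> < \<infinity>"
    using order_le_less_trans[OF 1 C] order_le_less_trans[OF 2 fin] by simp
  finally show ?case .
qed

lemma pos_part_finite:
  assumes neg: "\<And>j. j \<le> N \<Longrightarrow> (\<integral>\<^sup>+\<omega>. ennreal (- Y j \<omega>) * indicator (fin j) \<omega> \<partial>M) < \<infinity>"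
  shows "(\<integral>\<^sup>+\<omega>. ennreal (Y k \<omega>) * indicator (fin k) \<omega> \<partial>M) < \<infinity>"
proof -
  let ?S = "\<Sum>j\<in>{0..N}. \<integral>\<^sup>+\<omega>. ennreal (- 1 * Y j \<omega>) * indicator (fin j) \<omega> \<partial>M"
  \<comment> \<open>The mean of \<open>Z n\<close> is that of \<open>X 0\<close>, and
    \<open>?S\<close> bounds the mean of its negative part, so \<open>?C\<close> bounds the mean of
    its positive part for every \<open>n\<close>.\<close>
  let ?C = "ennreal \<bar>LINT \<omega>|M. X 0 \<omega>\<bar> + ?S"
  have C: "?C < \<infinity>" using neg by (auto simp: ennreal_sum_less_top)
  have Z: "(\<integral>\<^sup>+\<omega>. ennreal (Z n \<omega>) \<partial>M) \<le> ?C" for n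
  proof -
    have sp: "space M \<in> sets (F 0)"
      using filtration sets.top[of "F 0"] by (simp add: filtration_on_def)
    have X0: "stopped_process X (\<tau> n) 0 = X 0" by (simp add: stopped_process_def fun_eq_iff)
    have "(LINT \<omega>:space M|M. Z n \<omega>) = (LINT \<omega>:space M|M. stopped_process X (\<tau> n) 0 \<omega>)"
      using martingale_stopped[of n] sp unfolding martingale_on_def Z_def by (meson of_nat_0_le_iff order_refl)
    moreover have "integrable M (stopped_process X (\<tau> n) 0)"
      using martingale_stopped[of n] unfolding martingale_on_def by blast
    ultimately have E: "(LINT \<omega>|M. Z n \<omega>) = (LINT \<omega>|M. X 0 \<omega>)"
      using integrable_Z[of n] by (simp add: set_integral_space X0)
    have neg_le: "(\<integral>\<^sup>+\<omega>. ennreal (- Z n \<omega>) \<partial>M) \<le> ?S"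
    proof -
      have "(\<integral>\<^sup>+\<omega>. ennreal (- Z n \<omega>) \<partial>M) = (\<integral>\<^sup>+\<omega>. ennreal (- 1 * Z n \<omega>) * indicator (B n 0) \<omega> \<partial>M)"
        unfolding B_0 by (intro nn_integral_cong) simp
      also have "\<dots> \<le> ?S" by (rule nn_integral_Z_le)
      finally show ?thesis .
    qed
    let ?p = "\<integral>\<^sup>+\<omega>. ennreal (Z n \<omega>) \<partial>M" and ?m = "\<integral>\<^sup>+\<omega>. ennreal (- Z n \<omega>) \<partial>M"
    have fin: "?p \<noteq> \<infinity>" "?m \<noteq> \<infinity>" using integrable_Z[of n] by (auto simp: real_integrable_def)
    \<comment> \<open>The difference of the two parts is taken in the reals, where their finiteness
      makes it meaningful.\<close>
    have "enn2real ?p = (LINT \<omega>|M. X 0 \<omega>) + enn2real ?m"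
      using real_lebesgue_integral_def[OF integrable_Z[of n]] E by simp
    also have "\<dots> \<le> \<bar>LINT \<omega>|M. X 0 \<omega>\<bar> + enn2real ?m" by simp
    finally have "ennreal (enn2real ?p) \<le> ennreal (\<bar>LINT \<omega>|M. X 0 \<omega>\<bar> + enn2real ?m)" by (rule ennreal_leI)
    also have "\<dots> = ennreal \<bar>LINT \<omega>|M. X 0 \<omega>\<bar> + ?m"
      using fin by (simp add: top.not_eq_extremum)
    also have "\<dots> \<le> ?C" using neg_le by (rule add_left_mono)
    finally show ?thesis using fin by (simp add: top.not_eq_extremum)
  qed
  have "(\<integral>\<^sup>+\<omega>. ennreal (1 * Y k \<omega>) * indicator (B n k) \<omega> \<partial>M) \<le> ?C" for n
  proof -
    \<comment> \<open>Now \<open>Y_part_le\<close> is used with the largest set,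
      \<open>G = B n k\<close>, because the bound on \<open>Z n\<close> is already global.\<close>
    have "(\<integral>\<^sup>+\<omega>. ennreal (1 * Y k \<omega>) * indicator (B n k) \<omega> \<partial>M)
        \<le> (\<integral>\<^sup>+\<omega>. ennreal (1 * Z n \<omega>) * indicator (B n k) \<omega> \<partial>M)"
      using B_Suc_subset by (intro Y_part_le) auto
    also have "\<dots> \<le> (\<integral>\<^sup>+\<omega>. ennreal (Z n \<omega>) \<partial>M)"
      by (intro nn_integral_mono) (auto simp: indicator_def)
    finally show ?thesis using Z order_trans by blast
  qed
  then have "(\<integral>\<^sup>+\<omega>. ennreal (1 * Y k \<omega>) * indicator (fin k) \<omega> \<partial>M) \<le> ?C"
    by (intro nn_integral_fin_le) measurable
  then show ?thesis using C by (simp add: order_le_less_trans)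
qed

section \<open>Domination and passage to the limit\<close>

lemma UI_martingale:
  assumes "(\<integral>\<^sup>+ \<omega>. Liminf at_top (\<lambda>t. ennreal (- X t \<omega>)) \<partial>M) < \<infinity>"
  shows "UI_martingale_on M F X"
proof -
  \<comment> \<open>Every value of a path, stopped or not, is some \<open>Y k\<close> with
    \<open>k \<le> N\<close> at a point of \<open>fin k\<close>, hence bounded by
    \<open>H\<close>.\<close>
  define H where "H \<omega> = (\<Sum>k\<le>N. \<bar>Y k \<omega>\<bar> * indicator (fin k) \<omega>)" for \<omega>
  have neg: "(\<integral>\<^sup>+\<omega>. ennreal (- Y k \<omega>) * indicator (fin k) \<omega> \<partial>M) < \<infinity>" if "k \<le> N" for k
    using neg_part_finite[OF assms that] .
  have "integrable M (\<lambda>\<omega>. \<bar>Y k \<omega>\<bar> * indicator (fin k) \<omega>)" if "k \<le> N" for k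
  proof (rule integrableI_bounded)
    have "(\<integral>\<^sup>+\<omega>. ennreal (norm (\<bar>Y k \<omega>\<bar> * indicator (fin k) \<omega>)) \<partial>M)
        = (\<integral>\<^sup>+\<omega>. ennreal (Y k \<omega>) * indicator (fin k) \<omega> + ennreal (- Y k \<omega>) * indicator (fin k) \<omega> \<partial>M)"
      by (intro nn_integral_cong) (auto simp: indicator_def abs_if ennreal_neg)
    also have "\<dots> = (\<integral>\<^sup>+\<omega>. ennreal (Y k \<omega>) * indicator (fin k) \<omega> \<partial>M)
        + (\<integral>\<^sup>+\<omega>. ennreal (- Y k \<omega>) * indicator (fin k) \<omega> \<partial>M)"
      by (intro nn_integral_add) auto
    also have "\<dots> < \<infinity>" using neg[OF that] pos_part_finite[OF neg] by simp
    finally show "(\<integral>\<^sup>+\<omega>. ennreal (norm (\<bar>Y k \<omega>\<bar> * indicator (fin k) \<omega>)) \<partial>M) < \<infinity>" .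
  qed measurable
  then have H: "integrable M H"
    unfolding H_def by (intro Bochner_Integration.integrable_sum) auto
  have Y_le: "\<bar>Y k \<omega>\<bar> \<le> H \<omega>" if "k \<le> N" "\<omega> \<in> fin k" for k \<omega>
  proof -
    have "\<bar>Y k \<omega>\<bar> = (\<Sum>k\<in>{k}. \<bar>Y k \<omega>\<bar> * indicator (fin k) \<omega>)" using that by simp
    also have "\<dots> \<le> H \<omega>" unfolding H_def using that by (intro sum_mono2) auto
    finally show ?thesis .
  qed
  have X_le: "\<bar>X t \<omega>\<bar> \<le> H \<omega>" if "0 \<le> t" "\<omega> \<in> space M" for t \<omega>
    using position[OF that(2,1)] Y_le by metis
  have mart: "martingale_on M F X"
  proof (rule martingale_on_dominated_limit[OF filtration martingale_stopped adapted _ H])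
    fix t :: real assume t: "0 \<le> t"
    show "AE \<omega> in M. (\<lambda>n. stopped_process X (\<tau> n) t \<omega>) \<longlonglongrightarrow> X t \<omega>"
      using \<tau>_tendsto
    proof eventually_elim
      case (elim \<omega>)
      have "\<forall>\<^sub>F n in sequentially. ennreal t < \<tau> n \<omega>"
        using elim by (rule order_tendstoD(1)) simp
      then show ?case
        by (intro tendsto_eventually) (auto elim!: eventually_mono simp: stopped_process_def)
    qed
    show "\<bar>stopped_process X (\<tau> n) t \<omega>\<bar> \<le> H \<omega>" if "\<omega> \<in> space M" for n \<omega>
      using X_le[OF _ that] t by (auto simp: stopped_process_eq)
  qed
  moreover have "uniformly_integrable_on M X"
    using mart X_le by (intro uniformly_integrable_on_dominated[OF H]) (auto simp: martingale_on_def)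
  ultimately show ?thesis by (simp add: UI_martingale_on_def)
qed

end

section \<open>Sums of jumps as piecewise constant processes\<close>

theorem theorem1p1:
  fixes M :: "'a measure" and F :: "real \<Rightarrow> 'a measure" and N :: nat
    and \<rho> :: "nat \<Rightarrow> 'a \<Rightarrow> ennreal" and J :: "nat \<Rightarrow> 'a \<Rightarrow> real"
    and X :: "real \<Rightarrow> 'a \<Rightarrow> real"
  assumes "prob_space M"
    and "filtration_on M F"
    and "\<forall>m\<in>{1..N}. stopping_time_on F (\<rho> m)"
    and "\<forall>m\<in>{1..<N}. \<forall>\<omega>\<in>space M. \<rho> m \<omega> \<le> \<rho> (Suc m) \<omega>"
    and "\<forall>m\<in>{1..N}. J m \<in> borel_measurable (pre_sigma_on F (\<rho> m))"
    and "X = (\<lambda>t \<omega>. \<Sum>m=1..N. (if \<rho> m \<omega> \<le> ennreal t then J m \<omega> else 0))"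
    and "local_martingale_on M F X"
    and "(\<integral>\<^sup>+ \<omega>. Liminf at_top (\<lambda>t. ennreal (max (- X t \<omega>) 0)) \<partial>M) < \<infinity>"
  shows "UI_martingale_on M F X"
proof -
  interpret prob_space M by fact
  obtain \<tau> :: "nat \<Rightarrow> 'a \<Rightarrow> ennreal" where \<tau>: "\<And>n. stopping_time_on F (\<tau> n)"
      "AE \<omega> in M. (\<lambda>n. \<tau> n \<omega>) \<longlonglongrightarrow> \<infinity>" "\<And>n. martingale_on M F (stopped_process X (\<tau> n))"
    and adapted: "adapted_on F X"
    using assms(7) unfolding local_martingale_on_def UI_martingale_on_def by blast
  have F: "space (F t) = space M" "sets (F t) \<subseteq> sets M" if "0 \<le> t" for t
    using assms(2) that by (auto simp: filtration_on_def)
  define R where "R k \<omega> = (if k = 0 then 0 else if k \<le> N then \<rho> k \<omega> else \<infinity>)" for k \<omega>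
  have R_stop: "stopping_time_on F (R k)" for k
  proof -
    consider "k = 0" | "k \<in> {1..N}" | "N < k" by fastforce
    then show ?thesis
    proof cases
      case 2
      then have "R k = \<rho> k" by (auto simp: R_def fun_eq_iff)
      then show ?thesis using assms(3) 2 by simp
    qed (auto simp: R_def stopping_time_on_def top_unique)
  qed
  have R_Suc: "R k \<omega> \<le> R (Suc k) \<omega>" if "\<omega> \<in> space M" for k \<omega>
    using assms(4) that by (auto simp: R_def)
  then have R_mono: "R i \<omega> \<le> R j \<omega>" if "\<omega> \<in> space M" "i \<le> j" for i j \<omega>
    using lift_Suc_mono_le[of "\<lambda>k. R k \<omega>"] that by blast
  have R_meas [measurable]: "R k \<in> borel_measurable M" for k
    by (rule borel_measurable_stopping_time_on[OF assms(2) R_stop])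
  have \<rho>_meas: "\<rho> m \<in> borel_measurable M" if "m \<in> {1..N}" for m
    using borel_measurable_stopping_time_on[OF assms(2)] assms(3) that by blast
  have J_meas: "J m \<in> borel_measurable M" if "m \<in> {1..N}" for m
  proof -
    have inf: "F_infty F \<subseteq> sets M"
      unfolding F_infty_def using F by (auto intro!: sets.sigma_sets_subset)
    have "sets (pre_sigma_on F (\<rho> m)) \<subseteq> sets M"
      unfolding pre_sigma_on_def using inf sets.space_closed F(1)[of 0]
      by (subst sets_measure_of) (auto intro!: sets.sigma_sets_subset)
    moreover have "space (pre_sigma_on F (\<rho> m)) = space M"
      unfolding pre_sigma_on_def using F(1)[of 0] by (simp add: space_measure_of_conv)
    moreover have "J m \<in> borel_measurable (pre_sigma_on F (\<rho> m))" using assms(5) that by blast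
    ultimately show ?thesis using measurable_mono[of borel borel] by blast
  qed
  interpret piecewise_constant_local_martingale M F R N X \<tau>
  proof
    fix k \<omega> and t :: real
    assume \<omega>: "\<omega> \<in> space M" and t: "0 \<le> t" "R k \<omega> \<le> ennreal t" "ennreal t < R (Suc k) \<omega>"
    have Rk: "ennreal (enn2real (R k \<omega>)) = R k \<omega>"
      using t(2) ennreal_enn2real order_le_less_trans ennreal_less_top by blast
    \<comment> \<open>The sum depends on time only through the set of \<open>m\<close> with
      \<open>\<rho> m\<close> already reached, and this set is the same at \<open>t\<close> as at
      \<open>R k\<close>.\<close>
    have "\<rho> m \<omega> \<le> ennreal t \<longleftrightarrow> \<rho> m \<omega> \<le> R k \<omega>" if "m \<in> {1..N}" for m
    proof -
      have Rm: "\<rho> m \<omega> = R m \<omega>" using that by (auto simp: R_def)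
      show ?thesis
      proof (cases "m \<le> k")
        case True
        then show ?thesis using R_mono[OF \<omega> True] t(2) Rm by (metis order_trans)
      next
        case False
        then have "ennreal t < \<rho> m \<omega>" using R_mono[OF \<omega>, of "Suc k" m] t(3) Rm by (metis not_less_eq_eq order_less_le_trans)
        then show ?thesis using t(2) by (metis leD order_le_less_trans)
      qed
    qed
    then show "X t \<omega> = X (enn2real (R k \<omega>)) \<omega>"
      unfolding assms(6) Rk by (intro sum.cong) auto
  next
    fix k
    show "(\<lambda>\<omega>. X (enn2real (R k \<omega>)) \<omega>) \<in> borel_measurable M"
      unfolding assms(6)
    proof (rule borel_measurable_sum)
      fix m assume m: "m \<in> {1..N}"
      note [measurable] = \<rho>_meas[OF m] J_meas[OF m]
      show "(\<lambda>\<omega>. if \<rho> m \<omega> \<le> ennreal (enn2real (R k \<omega>)) then J m \<omega> else 0) \<in> borel_measurable M"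
        by measurable
    qed
  qed (use assms(2) R_stop R_Suc \<tau> adapted in \<open>auto simp: R_def\<close>)
  \<comment> \<open>The truncation built into \<open>ennreal\<close> makes the explicit negative
    part agree with the form used in the locale.\<close>
  have "ennreal (max (- x) 0) = ennreal (- x)" for x :: real
    by (auto simp: max_def ennreal_neg)
  then show ?thesis
    using assms(8) by (intro UI_martingale) simp
qed

end
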